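(* For every real number $x$ with $0<x<\pi/2$, $$\frac{\sin x}{x} > \left(\frac{2}{\pi}+\frac{\pi-2}{\pi^{3}}\left(\pi^{2}-4x^{2}\right)\right)^{\theta(x)},$$ where $$\theta(x) = -\frac{(48-24\pi+\pi^{3})\,x^{3}}{3(\pi-2)\pi^{3}}+\frac{\pi^{3}}{24(\pi-2)}.$$
   Context: All quantities are real; the power is the real power $a^{b}=\exp(b\ln a)$ of a positive base $a$ (the base $\frac{2}{\pi}+\frac{\pi-2}{\pi^{3}}(\pi^{2}-4x^{2})$ is positive for $0<x<\pi/2$). *)

theory Defs
  imports Complex_Main
begin

definition theta :: "real \<Rightarrow> real" where
  "theta x = - ((48 - 24 * pi + pi ^ 3) * x ^ 3) / (3 * (pi - 2) * pi ^ 3)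
     + pi ^ 3 / (24 * (pi - 2))"

end

theory Submission
  imports Defs "HOL-Analysis.Complex_Transcendental" "HOL-Real_Asymp.Real_Asymp"
begin

text \<open>
  With \<open>k = 4 (\<pi> - 2) / \<pi>^3\<close> the base is \<open>1 - k x^2\<close> and \<open>\<theta>(x) = 1/(6k) - B x^3\<close>. The difference
  \<open>F(x) = ln (sin x / x) - \<theta>(x) ln (1 - k x^2)\<close> is of order \<open>x^4\<close> at 0 and vanishes at \<open>\<pi>/2\<close>, where
  \<open>\<theta> = 1\<close>; it is positive because \<open>F(x) / x^4\<close> is strictly decreasing, that is
  \<open>x F'(x) - 4 F(x) < 0\<close>. In this combination the trigonometric part is at most \<open>x^2 / 3\<close>
  (its \<open>x^4\<close> term cancels and all higher terms are negative), and what remains is a comparison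
  of functions of \<open>u = k x^2 < 2/5\<close> together with the numerical inequality \<open>k \<pi> / 15 < B\<close>.
\<close>

section \<open>Derivative test and trigonometric inequalities\<close>

lemma nonneg_if_deriv_nonneg:
  fixes f f' :: "real \<Rightarrow> real"
  assumes "f 0 = 0"
    and "\<And>y. 0 \<le> y \<Longrightarrow> y \<le> a \<Longrightarrow> (f has_real_derivative f' y) (at y)"
    and "\<And>y. 0 \<le> y \<Longrightarrow> y \<le> a \<Longrightarrow> 0 \<le> f' y"
    and "0 \<le> x" "x \<le> a"
  shows "0 \<le> f x"
proof -
  have "f 0 \<le> f x"
  proof (rule DERIV_nonneg_imp_nondecreasing[where f = f])
    fix y assume "0 \<le> y" "y \<le> x"
    with assms have "(f has_real_derivative f' y) (at y) \<and> 0 \<le> f' y" by simp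
    then show "\<exists>D. (f has_real_derivative D) (at y) \<and> 0 \<le> D" by blast
  qed (rule \<open>0 \<le> x\<close>)
  with assms(1) show ?thesis by simp
qed

lemma sin_ge_mult_cos:
  fixes y :: real
  assumes "0 \<le> y" "y \<le> pi"
  shows "0 \<le> sin y - y * cos y"
  by (rule nonneg_if_deriv_nonneg[where f' = "\<lambda>y. y * sin y" and a = pi])
    (use assms in \<open>auto intro!: derivative_eq_intros mult_nonneg_nonneg sin_ge_zero\<close>)

text \<open>Four differentiations reduce this to \<open>sin y - y * cos y \<ge> 0\<close>; each of the
  intermediate derivatives vanishes at 0.\<close>

lemma trig_polynomial_nonneg:
  fixes y :: real
  assumes "0 \<le> y" "y \<le> pi"
  shows "0 \<le> 4 * y^2 - 24 + (24 - y^2) * cos y + 9 * y * sin y"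
proof -
  define g3 where "g3 = (\<lambda>y::real. (3 - y^2) * sin y - 3 * y * cos y)"
  define g2 where "g2 = (\<lambda>y::real. 8 - 5 * y * sin y + (y^2 - 8) * cos y)"
  define g1 where "g1 = (\<lambda>y::real. 8 * y + 7 * y * cos y + (y^2 - 15) * sin y)"
  define g where "g = (\<lambda>y::real. 4 * y^2 - 24 + (24 - y^2) * cos y + 9 * y * sin y)"
  have zero: "g3 0 = 0" "g2 0 = 0" "g1 0 = 0" "g 0 = 0"
    by (simp_all add: g3_def g2_def g1_def g_def)
  have deriv:
    "(g3 has_real_derivative y * (sin y - y * cos y)) (at y)"
    "(g2 has_real_derivative g3 y) (at y)"
    "(g1 has_real_derivative g2 y) (at y)"
    "(g has_real_derivative g1 y) (at y)" for y
    unfolding g3_def g2_def g1_def g_def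
    by (rule derivative_eq_intros refl | simp add: algebra_simps power2_eq_square)+
  have "0 \<le> g3 y" if "0 \<le> y" "y \<le> pi" for y
    by (rule nonneg_if_deriv_nonneg[OF zero(1) deriv(1) mult_nonneg_nonneg[OF _ sin_ge_mult_cos] that])
  then have "0 \<le> g2 y" if "0 \<le> y" "y \<le> pi" for y
    using nonneg_if_deriv_nonneg[OF zero(2) deriv(2) _ that] by blast
  then have "0 \<le> g1 y" if "0 \<le> y" "y \<le> pi" for y
    using nonneg_if_deriv_nonneg[OF zero(3) deriv(3) _ that] by blast
  then have "0 \<le> g y"
    using nonneg_if_deriv_nonneg[OF zero(4) deriv(4) _ assms] by blast
  then show ?thesis by (simp add: g_def)
qed

text \<open>The factor 4 matches the exponent in \<open>F y / y^4\<close>. The gap \<open>p\<close>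
  between the two sides has right limit 0 at 0 and is nondecreasing: after clearing denominators,
  its derivative is the expression of \<open>trig_polynomial_nonneg\<close> taken at
  \<open>2*y\<close>, which stays below \<open>pi\<close>.\<close>

lemma x_cot_minus_ln_sinc_le:
  fixes x :: real
  assumes "0 < x" "x < pi / 2"
  shows "x * cos x / sin x - 1 - 4 * ln (sin x / x) \<le> x^2 / 3"
proof -
  define p where "p = (\<lambda>x::real. x^2 / 3 + 1 - x * cos x / sin x + 4 * ln (sin x / x))"
  have deriv: "\<exists>D. (p has_real_derivative D) (at y) \<and> D \<ge> 0" if y: "0 < y" "y \<le> x" for y
  proof -
    have s: "sin y > 0" using y assms by (intro sin_gt_zero) auto
    define D where "D = 2 * y / 3 + 3 * cos y / sin y + y / (sin y)^2 - 4 / y"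
    have cs: "cos y * cos y = 1 - sin y * sin y"
      using sin_cos_squared_add[of y] by (simp add: power2_eq_square)
    have der: "(p has_real_derivative D) (at y)"
      unfolding p_def D_def
      by (rule derivative_eq_intros refl | use y s in force)+
        (use y s in \<open>simp add: field_simps power2_eq_square cs\<close>)
    have "0 \<le> 4 * (2*y)^2 - 24 + (24 - (2*y)^2) * cos (2*y) + 9 * (2*y) * sin (2*y)"
      by (rule trig_polynomial_nonneg) (use y assms in auto)
    also have "\<dots> = 12 * (y * (sin y)^2) * D"
      using y s unfolding D_def cos_double_sin sin_double
      by (simp add: field_simps power2_eq_square)
    finally have "0 \<le> 12 * (y * (sin y)^2) * D" .
    moreover have "0 < 12 * (y * (sin y)^2)"
      using y s by simp
    ultimately have "D \<ge> 0"
      by (simp only: zero_le_mult_iff) linarith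
    with der show ?thesis by blast
  qed
  \<comment> \<open>The formula for \<open>p\<close> is singular at 0, so its right limit there
    takes the place of a value at 0.\<close>
  have "(p \<longlongrightarrow> 0) (at_right 0)"
    unfolding p_def by real_asymp
  moreover have "\<forall>\<^sub>F y in at_right 0. p y \<le> p x"
    unfolding eventually_at_right_field
  proof (intro exI[of _ x] conjI allI impI)
    fix y assume "0 < y" "y < x"
    then show "p y \<le> p x"
      by (intro DERIV_nonneg_imp_nondecreasing[where f = p] deriv) auto
  qed (use assms in auto)
  ultimately have "0 \<le> p x"
    by (rule tendsto_upperbound) simp
  then show ?thesis by (simp add: p_def)
qed

section \<open>Bounds for the logarithm\<close>

lemma ln_one_minus_le_poly:
  fixes u :: real
  assumes "0 \<le> u" "u < 1"
  shows "ln (1 - u) \<le> - (u + u^2/2 + u^3/3 + u^4/4 + u^5/5)"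
proof -
  define r where "r = (\<lambda>u::real. - (u + u^2/2 + u^3/3 + u^4/4 + u^5/5) - ln (1 - u))"
  have "0 \<le> r u"
  proof (rule nonneg_if_deriv_nonneg[where f = r and a = u and f' = "\<lambda>u. u^5 / (1 - u)"])
    fix y :: real assume y: "0 \<le> y" "y \<le> u"
    show "(r has_real_derivative y^5 / (1 - y)) (at y)"
      unfolding r_def
      by (rule derivative_eq_intros refl | use y assms in force)+
        (use y assms in \<open>simp add: field_simps eval_nat_numeral\<close>)
  qed (use assms in \<open>auto simp: r_def\<close>)
  then show ?thesis by (simp add: r_def)
qed

text \<open>At 0 the two sides behave like \<open>2/3 * u^3\<close> and \<open>4/5 * u^3\<close>.
  The constant 4/5 exceeds 2/3 but is small enough for the numerical bound \<open>kB\<close> in the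
  theorem. Replacing \<open>- ln (1 - u)\<close> by its Taylor polynomial \<open>L\<close> and
  multiplying by \<open>1 - u\<close> leaves a polynomial inequality.\<close>

lemma ln_rational_comparison:
  fixes u :: real
  assumes "0 < u" "u \<le> 2/5"
  shows "2*u + 2*u/(1 - u) + 4 * ln (1 - u) < 4/5 * u^2 * (2*u/(1 - u) + ln (1 - u))"
proof -
  define L where "L = u + u^2/2 + u^3/3 + u^4/4 + u^5/5"
  have u2: "u^2 \<le> (2/5)^2" and u3: "u^3 \<le> (2/5)^3"
    using assms by (intro power_mono; simp)+
  \<comment> \<open>For \<open>u \<le> 2/5\<close> the two negative terms together stay below the
    constant term 2/15.\<close>
  then have "0 < 2/15 + u/15 - u^2/15 - 11/15*u^3 + u^4/25 + 4/25*u^5"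
    using assms by (simp add: power_divide add_pos_nonneg add_nonneg_pos)
  then have "0 < u^3 * (2/15 + u/15 - u^2/15 - 11/15*u^3 + u^4/25 + 4/25*u^5)"
    using assms by simp
  also have "\<dots> = (4 - 4/5*u^2) * (1 - u) * L - 2*u*(1 - u) - 2*u + 8/5*u^3"
    by (simp add: L_def field_simps eval_nat_numeral)
  also have "\<dots> = (1 - u) * ((4 - 4/5*u^2) * L - (2*u + 2*u/(1 - u) - 8/5*u^3/(1 - u)))"
  proof -
    have "(1 - u) * (2*u / (1 - u)) = 2*u" "(1 - u) * (8/5*u^3 / (1 - u)) = 8/5*u^3"
      using assms by (intro nonzero_mult_div_cancel_left[of "1 - u", folded times_divide_eq_right]; simp)+
    then show ?thesis unfolding right_diff_distrib[of "1 - u"] distrib_left[of "1 - u"]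
      by (simp only: mult_ac)
  qed
  finally have "2*u + 2*u/(1 - u) - 8/5*u^3/(1 - u) < (4 - 4/5*u^2) * L"
    using assms by (simp add: zero_less_mult_iff)
  also have "\<dots> \<le> (4 - 4/5*u^2) * (- ln (1 - u))"
    using assms u2 ln_one_minus_le_poly[of u]
    by (intro mult_left_mono) (auto simp: L_def power_divide)
  finally have "2*u + 2*u/(1 - u) + 4 * ln (1 - u) < 8/5*u^3/(1 - u) + 4/5*u^2 * ln (1 - u)"
    by (simp add: left_diff_distrib)
  also have "8/5*u^3/(1 - u) = 4/5*u^2 * (2*u/(1 - u))"
    by (simp add: eval_nat_numeral)
  finally show ?thesis
    by (simp only: distrib_left)
qed

section \<open>Monotonicity of \<open>F y / y^4\<close> and the conclusion\<close>

theorem mainTheorem1: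
  fixes x :: real
  assumes "0 < x" and "x < pi / 2"
  shows "sin x / x > (2 / pi + (pi - 2) / pi ^ 3 * (pi ^ 2 - 4 * x ^ 2)) powr (theta x)"
proof -
  have pi: "157/50 < pi" "pi < 22/7"
    using pi_approx by simp_all
  define k where "k = 4 * (pi - 2) / pi^3"
  define B where "B = (48 - 24 * pi + pi^3) / (3 * (pi - 2) * pi^3)"
  have k: "k > 0" using pi by (simp add: k_def)
  have base: "2 / pi + (pi - 2) / pi ^ 3 * (pi ^ 2 - 4 * y ^ 2) = 1 - k * y^2" for y
    using pi by (simp add: k_def field_simps eval_nat_numeral)
  have theta: "theta y = 1 / (6*k) - B * y^3" for y
    using pi by (simp add: theta_def k_def B_def)
  have kB: "2/15 * k * (pi / 2) < B"
  proof -
    \<comment> \<open>This is \<open>kB\<close> multiplied by \<open>3 * (pi - 2) * pi^3\<close>.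
      Bounding \<open>pi^2\<close> below by its tangent at 157/50 and \<open>pi^3\<close> by a
      constant makes it linear in \<open>pi\<close>.\<close>
    have "0 < 48 - 24 * pi + pi^3 - 4/5 * pi * (pi - 2)^2"
    proof -
      have "(157/50)^3 \<le> pi^3" using pi by (intro power_mono) auto
      then have "30 + 9/10 \<le> pi^3" by (simp add: power_divide)
      moreover have "0 \<le> (pi - 157/50)^2" by simp
      then have "157/25 * pi - 24649/2500 \<le> pi^2"
        by (simp add: power2_diff power_divide)
      moreover have "48 - 24 * pi + pi^3 - 4/5 * pi * (pi - 2)^2
          = 48 - 136/5 * pi + 16/5 * pi^2 + pi^3 / 5"
        by (simp add: field_simps eval_nat_numeral)
      ultimately show ?thesis using pi by linarith
    qed
    then have "0 < (48 - 24 * pi + pi^3 - 4/5 * pi * (pi - 2)^2) / (3 * (pi - 2) * pi^3)"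
      using pi by simp
    also have "\<dots> = B - 2/15 * k * (pi / 2)"
      using pi by (simp add: k_def B_def field_simps eval_nat_numeral)
    finally show ?thesis by simp
  qed
  \<comment> \<open>This keeps the base positive and puts \<open>k * y^2\<close> in the range of
    \<open>ln_rational_comparison\<close>.\<close>
  have u: "0 < k * y^2" "k * y^2 \<le> 2/5" if "0 < y" "y \<le> pi/2" for y
  proof -
    show "0 < k * y^2" using k that by simp
    have "k * y^2 \<le> k * (pi/2)^2"
      using k that by (intro mult_left_mono power_mono) auto
    also have "\<dots> = 1 - 2/pi"
      using pi by (simp add: k_def field_simps eval_nat_numeral)
    also have "\<dots> \<le> 2/5"
      using pi by (simp add: field_simps)
    finally show "k * y^2 \<le> 2/5" .
  qed
  define F where "F = (\<lambda>y. ln (sin y / y) - (1 / (6*k) - B * y^3) * ln (1 - k * y^2))"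
  define F' where "F' = (\<lambda>y. cos y / sin y - 1 / y + 3 * B * y^2 * ln (1 - k * y^2)
    + (1 / (6*k) - B * y^3) * (2 * k * y / (1 - k * y^2)))"
  have F': "(F has_real_derivative F' y) (at y)" if y: "0 < y" "y \<le> pi/2" for y
  proof -
    have s: "sin y > 0" using y pi by (intro sin_gt_zero) auto
    have "((\<lambda>y. ln (sin y / y)) has_real_derivative cos y / sin y - 1 / y) (at y)"
      by (rule derivative_eq_intros refl | use y s in force)+
        (use y s in \<open>simp add: field_simps\<close>)
    moreover have "((\<lambda>y. ln (1 - k * y^2)) has_real_derivative - (2 * k * y / (1 - k * y^2))) (at y)"
      by (rule derivative_eq_intros refl | use u[OF y] in force)+
    moreover have "((\<lambda>y. 1 / (6*k) - B * y^3) has_real_derivative - (3 * B * y^2)) (at y)"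
      by (rule derivative_eq_intros refl)+ simp
    ultimately have "(F has_real_derivative (cos y / sin y - 1 / y)
        - (- (3 * B * y^2) * ln (1 - k * y^2)
          + - (2 * k * y / (1 - k * y^2)) * (1 / (6*k) - B * y^3))) (at y)"
      unfolding F_def by (intro DERIV_diff DERIV_mult)
    also have "(cos y / sin y - 1 / y)
        - (- (3 * B * y^2) * ln (1 - k * y^2)
          + - (2 * k * y / (1 - k * y^2)) * (1 / (6*k) - B * y^3)) = F' y"
      unfolding F'_def by (simp only: minus_mult_left[symmetric] mult.commute)
    finally show ?thesis .
  qed
  have H': "((\<lambda>y. F y / y^4) has_real_derivative (y * F' y - 4 * F y) / y^5) (at y)"
    if y: "0 < y" "y \<le> pi/2" for y
  proof -
    have "((\<lambda>y. F y / y^4) has_real_derivative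
        (F' y * y^4 - F y * (4 * y^3)) / (y^4 * y^4)) (at y)"
      using y F'[OF y] DERIV_pow[of 4 y] by (intro DERIV_divide) auto
    also have "(F' y * y^4 - F y * (4 * y^3)) / (y^4 * y^4)
        = (y^3 * (y * F' y - 4 * F y)) / (y^3 * y^5)"
      by (simp add: algebra_simps eval_nat_numeral)
    also have "\<dots> = (y * F' y - 4 * F y) / y^5"
      using y by (intro mult_divide_mult_cancel_left) simp
    finally show ?thesis .
  qed
  have neg: "y * F' y - 4 * F y < 0" if y: "0 < y" "y < pi/2" for y
  proof -
    define u where "u = k * y^2"
    have u: "0 < u" "u \<le> 2/5" using u[of y] y by (auto simp: u_def)
    define R where "R = 2*u/(1 - u) + ln (1 - u)"
    define q where "q = 2*u/(1 - u)"
    have "y * (2 * k * y / (1 - u)) = q"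
      by (simp add: q_def u_def power2_eq_square)
    moreover have "y * (cos y / sin y - 1 / y) = y * cos y / sin y - 1"
      using y by (simp add: right_diff_distrib)
    moreover have "y * F' y = y * (cos y / sin y - 1 / y) + 3 * B * y^3 * ln (1 - u)
        + (1 / (6*k) - B * y^3) * (y * (2 * k * y / (1 - u)))"
      unfolding F'_def u_def[symmetric] by (simp add: algebra_simps eval_nat_numeral)
    ultimately have "y * F' y = y * cos y / sin y - 1 + 3 * B * y^3 * ln (1 - u)
        + (1 / (6*k) - B * y^3) * q" by simp
    then have "y * F' y - 4 * F y = (y * cos y / sin y - 1 - 4 * ln (sin y / y))
        + (2*u/(1 - u) + 4 * ln (1 - u)) / (6*k) - B * y^3 * R"
      unfolding F_def R_def u_def[symmetric] q_def[symmetric]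
      by (simp add: algebra_simps add_divide_distrib)
    also have "\<dots> \<le> y^2/3 + (2*u/(1 - u) + 4 * ln (1 - u)) / (6*k) - B * y^3 * R"
      using x_cot_minus_ln_sinc_le[OF y] by simp
    \<comment> \<open>Since \<open>u = k * y^2\<close>, the trigonometric bound \<open>y^2/3\<close>
      is \<open>2*u / (6*k)\<close>.\<close>
    also have "\<dots> = (2*u + 2*u/(1 - u) + 4 * ln (1 - u)) / (6*k) - B * y^3 * R"
      using k by (simp add: u_def field_simps)
    also have "\<dots> < (4/5 * u^2 * R) / (6*k) - B * y^3 * R"
      using divide_strict_right_mono[OF ln_rational_comparison[OF u], of "6*k"] k
      unfolding R_def[symmetric] by linarith
    \<comment> \<open>Here \<open>u^2 / k = k * y^4\<close>, so \<open>y^3 * R\<close> factors out.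
      The bracket is largest at \<open>y = pi/2\<close>, where \<open>kB\<close> makes it negative;
      it remains to see that \<open>R \<ge> 0\<close>.\<close>
    also have "\<dots> = y^3 * R * (2/15 * k * y - B)"
      using k by (simp add: u_def field_simps eval_nat_numeral)
    also have "\<dots> \<le> 0"
    proof -
      have "- ln (1 - u) \<le> inverse (1 - u) - 1"
        using ln_le_minus_one[of "inverse (1 - u)"] u by (simp only: ln_inverse) simp
      also have "\<dots> = u / (1 - u)"
        using u by (simp add: field_simps)
      finally have "- ln (1 - u) \<le> u / (1 - u)" .
      moreover have "0 < u / (1 - u)" using u by simp
      ultimately have "R \<ge> 0" by (simp add: R_def)
      moreover have "2/15 * k * y \<le> 2/15 * k * (pi/2)"
        using k y by (intro mult_left_mono) auto
      ultimately show ?thesis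
        using kB y by (intro mult_nonneg_nonpos) auto
    qed
    finally show ?thesis .
  qed
  have "F (pi/2) / (pi/2)^4 < F x / x^4"
  \<comment> \<open>The sign in \<open>neg\<close> is known only for \<open>y < pi/2\<close>, so the
    right endpoint enters by continuity.\<close>
  proof (rule DERIV_neg_imp_decreasing_open[OF assms(2)])
    fix y assume "x < y" "y < pi/2"
    then have "0 < y" "y \<le> pi/2" "y < pi/2" using assms by auto
    then show "\<exists>D. ((\<lambda>y. F y / y^4) has_real_derivative D) (at y) \<and> D < 0"
      by (intro exI conjI) (rule H', auto intro!: divide_neg_pos neg)
  next
    show "continuous_on {x..pi/2} (\<lambda>y. F y / y^4)"
      by (rule DERIV_continuous_on, rule has_field_derivative_at_within, rule H') (use assms in auto)
  qed
  \<comment> \<open>At \<open>pi/2\<close> the exponent is 1, and both the base and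
    \<open>sin y / y\<close> equal \<open>2/pi\<close>.\<close>
  moreover have "F (pi/2) = 0"
  proof -
    have "1 / (6*k) = pi^3 / (24 * (pi - 2))"
      by (simp add: k_def)
    moreover have "B * (pi/2)^3 = (48 - 24 * pi + pi^3) / (24 * (pi - 2))"
      by (simp add: B_def power_divide)
    ultimately have "1 / (6*k) - B * (pi/2)^3 = (24 * (pi - 2)) / (24 * (pi - 2))"
      by (simp add: diff_divide_distrib[symmetric])
    then have "1 / (6*k) - B * (pi/2)^3 = 1"
      using pi by simp
    moreover have "1 - k * (pi/2)^2 = 2/pi"
      using pi by (simp add: k_def field_simps eval_nat_numeral)
    ultimately show ?thesis by (simp add: F_def)
  qed
  ultimately have "0 < F x"
    using assms by (simp add: zero_less_divide_iff)
  then have "theta x * ln (1 - k * x^2) < ln (sin x / x)"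
    by (simp add: F_def theta)
  moreover have "sin x / x > 0"
    using assms by (intro divide_pos_pos sin_gt_zero) auto
  moreover have "1 - k * x^2 > 0" using u[of x] assms by simp
  ultimately show ?thesis
    unfolding base by (simp add: ln_less_cancel_iff[symmetric] ln_powr del: ln_less_cancel_iff)
qed

end
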